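(* Let $3\le s\le t$ be fixed integers with $s$ odd and $t$ even. Then, for all sufficiently large $n$ (depending on $s$ and $t$), $$r_{\mathrm{odd}}(n,K_{s,t})> n^{1/\left(\frac s2+\frac 1{2\lfloor t/8\rfloor}\right)}.$$
   Context: All graphs are finite and simple. $K_n$ is the complete graph on $n$ vertices and $K_{s,t}$ is the complete bipartite graph with parts of sizes $s$ and $t$. An $r$-coloring of a graph $G$ is a map $\chi:E(G)\to[r]=\{1,\dots,r\}$ (an edge-coloring, not necessarily proper or surjective). For a graph $H$, the odd-Ramsey number $r_{\mathrm{odd}}(n,H)$ is the minimum positive integer $r$ for which there is an $r$-coloring of $K_n$ such that in every (not necessarily induced) copy of $H$ in $K_n$ some color occurs on an odd number of edges of that copy. Convention: when $t<8$, so that $\lfloor t/8\rfloor=0$, the term $\frac{1}{2\lfloor t/8\rfloor}$ is read as $+\infty$ and the exponent as $0$, so the bound reads $r_{\mathrm{odd}}(n,K_{s,t})>1$. *)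

theory Defs
  imports Complex_Main "HOL-Library.Ramsey"
begin

text \<open>A graph is a pair of a vertex set and a set of two-element sets of vertices.\<close>

type_synonym 'a graph = "'a set \<times> 'a set set"

abbreviation verts :: "'a graph \<Rightarrow> 'a set" where
  "verts \<equiv> fst"

abbreviation edges :: "'a graph \<Rightarrow> 'a set set" where
  "edges \<equiv> snd"

definition complete_graph :: "nat \<Rightarrow> nat graph" where
  "complete_graph n = ({1..n}, [{1..n}]\<^bsup>2\<^esup>)"

definition complete_bipartite :: "nat \<Rightarrow> nat \<Rightarrow> (nat + nat) graph" where
  "complete_bipartite s t =
     ({1..s} <+> {1..t}, {{Inl i, Inr j} | i j. i \<in> {1..s} \<and> j \<in> {1..t}})"

definition graph_iso :: "'a graph \<Rightarrow> 'b graph \<Rightarrow> bool" where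
  "graph_iso H F \<longleftrightarrow>
     (\<exists>f. bij_betw f (verts H) (verts F) \<and> edges F = (\<lambda>e. f ` e) ` edges H)"

text \<open>Copies are arbitrary subgraphs, not only induced ones.\<close>

definition copies :: "'a graph \<Rightarrow> 'b graph \<Rightarrow> 'b graph set" where
  "copies H G = {F. verts F \<subseteq> verts G \<and> edges F \<subseteq> edges G \<and> graph_iso H F}"

definition odd_ramsey_coloring :: "nat \<Rightarrow> 'a graph \<Rightarrow> nat \<Rightarrow> (nat set \<Rightarrow> nat) \<Rightarrow> bool" where
  "odd_ramsey_coloring n H r \<chi> \<longleftrightarrow>
     \<chi> \<in> edges (complete_graph n) \<rightarrow> {1..r} \<and>
     (\<forall>F \<in> copies H (complete_graph n).
        \<exists>c \<in> {1..r}. odd (card {e \<in> edges F. \<chi> e = c}))"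

definition odd_ramsey :: "nat \<Rightarrow> 'a graph \<Rightarrow> nat" where
  "odd_ramsey n H = (LEAST r. r \<ge> 1 \<and> (\<exists>\<chi>. odd_ramsey_coloring n H r \<chi>))"

text \<open>The minimum is attained as soon as \<open>H\<close> has an edge: colour the edges of the
  complete graph with pairwise distinct colours.\<close>

lemma odd_ramsey_attained:
  assumes "edges H \<noteq> {}"
  shows "odd_ramsey n H \<ge> 1 \<and> (\<exists>\<chi>. odd_ramsey_coloring n H (odd_ramsey n H) \<chi>)"
proof -
  let ?E = "edges (complete_graph n)"
  have "finite ?E"
    unfolding complete_graph_def by (simp add: finite_imp_finite_nsets)
  then obtain \<chi> where \<chi>: "bij_betw \<chi> ?E {1..card ?E}"
    using finite_same_card_bij[of ?E "{1..card ?E}"] by (metis card_atLeastAtMost diff_Suc_1 finite_atLeastAtMost)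
  have "{1..card ?E} \<subseteq> {1..Suc (card ?E)}"
    by simp
  then have range: "\<And>e. e \<in> ?E \<Longrightarrow> \<chi> e \<in> {1..Suc (card ?E)}"
    using bij_betwE[OF \<chi>] by blast
  have "odd_ramsey_coloring n H (Suc (card ?E)) \<chi>"
    unfolding odd_ramsey_coloring_def
  proof (intro conjI ballI)
    show "\<chi> \<in> ?E \<rightarrow> {1..Suc (card ?E)}"
      using range by blast
  next
    fix F assume F: "F \<in> copies H (complete_graph n)"
    then obtain f where "edges F = (\<lambda>e. f ` e) ` edges H"
      by (auto simp: copies_def graph_iso_def)
    with assms obtain e where e: "e \<in> edges F"
      by (metis ex_in_conv image_is_empty)
    have sub: "edges F \<subseteq> ?E"
      using F by (simp add: copies_def)
    have "{e' \<in> edges F. \<chi> e' = \<chi> e} = {e}"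
    proof -
      have "e' = e" if "e' \<in> edges F" "\<chi> e' = \<chi> e" for e'
        using inj_onD[OF bij_betw_imp_inj_on[OF \<chi>] that(2)] that(1) e sub by (meson subsetD)
      with e show ?thesis by blast
    qed
    moreover have "\<chi> e \<in> {1..Suc (card ?E)}"
      using range e sub by blast
    ultimately show "\<exists>c \<in> {1..Suc (card ?E)}. odd (card {e' \<in> edges F. \<chi> e' = c})"
      by (intro bexI[of _ "\<chi> e"]) simp
  qed
  then have "\<exists>r. r \<ge> 1 \<and> (\<exists>\<chi>. odd_ramsey_coloring n H r \<chi>)"
    by (intro exI[of _ "Suc (card ?E)"] conjI exI[of _ \<chi>]) simp
  then show ?thesis
    unfolding odd_ramsey_def by (rule LeastI_ex)
qed

end

theory Submission
  imports Defs "HOL-Analysis.Convex" "HOL-Real_Asymp.Real_Asymp"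
begin

text \<open>
  Split the vertices into halves \<open>X\<close>, \<open>Y\<close> of size \<open>m\<close>. By convexity, counting the pairs of an
  \<open>s\<close>-subset \<open>S\<close> of \<open>X\<close> and two distinct vertices of \<open>Y\<close> that send the same colours to \<open>S\<close> shows
  that some \<open>S\<close> has at least of order \<open>m\<^sup>2 / r ^ s\<close> such pairs. Once this exceeds a constant
  depending on \<open>t\<close>, there are \<open>t / 2\<close> disjoint pairs; their union \<open>T\<close> and \<open>S\<close> span a copy of
  \<open>K\<^sub>s\<^sub>,\<^sub>t\<close> in which every colour occurs an even number of times. Hence \<open>r\<close> is at least of order
  \<open>n powr (2 / s)\<close>, which beats the claimed exponent.
\<close>

section \<open>Convexity and the number of pairs with equal values\<close>

lemma sum_power_ge_card_mult_power:
  fixes f :: "'a \<Rightarrow> real"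
  assumes nonneg: "\<And>p. p \<in> P \<Longrightarrow> 0 \<le> f p" and "0 < A" and mean: "real (card P) * A \<le> sum f P"
  shows "real (card P) * A ^ s \<le> (\<Sum>p\<in>P. f p ^ s)"
proof -
  \<comment> \<open>Tangent line of \<open>x ^ s\<close> at \<open>A\<close>.\<close>
  have tangent: "A ^ s * (1 + real s * (f p / A - 1)) \<le> f p ^ s" if "p \<in> P" for p
  proof -
    have "1 + real s * (f p / A - 1) \<le> (1 + (f p / A - 1)) ^ s"
      using nonneg[OF that] \<open>0 < A\<close> by (intro Bernoulli_inequality) simp
    then have "A ^ s * (1 + real s * (f p / A - 1)) \<le> A ^ s * (f p / A) ^ s"
      using \<open>0 < A\<close> by (intro mult_left_mono) auto
    also have "\<dots> = f p ^ s"
      using \<open>0 < A\<close> by (simp add: power_divide)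
    finally show ?thesis .
  qed
  have "(\<Sum>p\<in>P. f p / A) \<ge> card P"
    using mean \<open>0 < A\<close> by (simp add: sum_divide_distrib[symmetric] field_simps)
  \<comment> \<open>By \<open>mean\<close>, the slope terms of the tangent lines add up to a
    nonnegative amount, so only the constants \<open>A ^ s\<close> remain.\<close>
  then have "real (card P) * A ^ s \<le> A ^ s * (real (card P) + real s * ((\<Sum>p\<in>P. f p / A) - card P))"
    using \<open>0 < A\<close> by (simp add: mult.commute)
  also have "\<dots> = (\<Sum>p\<in>P. A ^ s * (1 + real s * (f p / A - 1)))"
    by (simp add: sum.distrib sum_subtractf sum_distrib_left[symmetric])
  also have "\<dots> \<le> (\<Sum>p\<in>P. f p ^ s)"
    by (intro sum_mono tangent)
  finally show ?thesis .
qed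

text \<open>Cauchy-Schwarz over the \<open>r\<close> fibres of \<open>f\<close>: their sizes add up
  to \<open>card Y\<close>, and the squares of the sizes count the ordered pairs, diagonal
  included.\<close>

lemma card_equal_value_pairs_ge:
  fixes f :: "'a \<Rightarrow> nat"
  assumes "finite Y" and "f \<in> Y \<rightarrow> {1..r}"
  shows "(card Y)\<^sup>2 \<le> card {(u, v) \<in> Y \<times> Y. f u = f v} * r"
proof -
  have fibres: "Y = (\<Union>c\<in>{1..r}. {y \<in> Y. f y = c})"
    using assms by auto
  have "real (card Y) = real (card (\<Union>c\<in>{1..r}. {y \<in> Y. f y = c}))"
    using arg_cong[OF fibres, of "\<lambda>A. real (card A)"] .
  also have "\<dots> = (\<Sum>c\<in>{1..r}. real (card {y \<in> Y. f y = c}))"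
    using assms by (subst card_UN_disjoint) auto
  finally have "(real (card Y))\<^sup>2 \<le> (\<Sum>c\<in>{1..r}. (real (card {y \<in> Y. f y = c}))\<^sup>2) * r"
    using sum_squared_le_sum_of_squares[of "\<lambda>c. real (card {y \<in> Y. f y = c})" "{1..r}"] by simp
  moreover have "{(u, v) \<in> Y \<times> Y. f u = f v} = (\<Union>c\<in>{1..r}. {y \<in> Y. f y = c} \<times> {y \<in> Y. f y = c})"
    using assms by auto
  then have "card {(u, v) \<in> Y \<times> Y. f u = f v} = (\<Sum>c\<in>{1..r}. (card {y \<in> Y. f y = c})\<^sup>2)"
    using assms by (simp only:) (subst card_UN_disjoint; force simp: card_cartesian_product power2_eq_square)
  ultimately have "(real (card Y))\<^sup>2 \<le> real (card {(u, v) \<in> Y \<times> Y. f u = f v} * r)"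
    by simp
  then show ?thesis
    by (simp only: of_nat_le_iff flip: of_nat_power)
qed

lemma card_equal_value_distinct_pairs_ge:
  fixes f :: "'a \<Rightarrow> nat"
  assumes "finite Y" and "f \<in> Y \<rightarrow> {1..r}" and "1 \<le> r"
  shows "(real (card Y))\<^sup>2 / real r - real (card Y) \<le> real (card {(u, v) \<in> Y \<times> Y. u \<noteq> v \<and> f u = f v})"
proof -
  have "{(u, v) \<in> Y \<times> Y. f u = f v} = {(u, v) \<in> Y \<times> Y. u \<noteq> v \<and> f u = f v} \<union> (\<lambda>y. (y, y)) ` Y"
    by auto
  moreover have "card ((\<lambda>y. (y, y)) ` Y) = card Y"
    by (intro card_image) (auto simp: inj_on_def)
  ultimately have "card {(u, v) \<in> Y \<times> Y. f u = f v} \<le> card {(u, v) \<in> Y \<times> Y. u \<noteq> v \<and> f u = f v} + card Y"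
    using card_Un_le[of "{(u, v) \<in> Y \<times> Y. u \<noteq> v \<and> f u = f v}" "(\<lambda>y. (y, y)) ` Y"] by (simp only:)
  then have "card {(u, v) \<in> Y \<times> Y. f u = f v} * r \<le> (card {(u, v) \<in> Y \<times> Y. u \<noteq> v \<and> f u = f v} + card Y) * r"
    by (rule mult_le_mono1)
  with card_equal_value_pairs_ge[OF assms(1,2)]
  have "(card Y)\<^sup>2 \<le> (card {(u, v) \<in> Y \<times> Y. u \<noteq> v \<and> f u = f v} + card Y) * r"
    by linarith
  then have "(real (card Y))\<^sup>2 \<le> (real (card {(u, v) \<in> Y \<times> Y. u \<noteq> v \<and> f u = f v}) + real (card Y)) * real r"
    by (simp only: of_nat_le_iff flip: of_nat_add of_nat_mult of_nat_power)
  then show ?thesis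
    using \<open>1 \<le> r\<close> by (simp add: field_simps)
qed

section \<open>Double counting: an s-subset with many agreeing pairs\<close>

lemma binomial_ge_power_max:
  assumes "1 \<le> s"
  shows "(max 0 (real d / real s - 1)) ^ s \<le> real (d choose s)"
proof (cases "s \<le> d")
  case True
  have "(max 0 (real d / real s - 1)) ^ s \<le> (real d / real s) ^ s"
    by (intro power_mono) auto
  also have "\<dots> \<le> real (d choose s)"
    by (rule binomial_ge_n_over_k_pow_k[OF True])
  finally show ?thesis .
next
  case False
  then show ?thesis
    using assms by (simp add: max_def field_simps zero_power)
qed

text \<open>Count incidences between ordered pairs \<open>p\<close> of distinct elements of
  \<open>Y\<close> and \<open>s\<close>-subsets of \<open>D p\<close>, the points at which
  \<open>p\<close> agrees. Convexity gives at least \<open>card P * A ^ s\<close> of them. There are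
  at most \<open>m ^ s\<close> sets \<open>S\<close>, so some \<open>S\<close> has at least the
  average, which \<open>size\<close> makes at least \<open>K\<close>.\<close>

lemma exists_subset_many_agreeing_pairs:
  fixes f :: "'a \<Rightarrow> 'b \<Rightarrow> nat" and m r s K :: nat
  assumes "finite X" "finite Y" "card X = m" "card Y = m"
    and range: "\<And>x. x \<in> X \<Longrightarrow> f x \<in> Y \<rightarrow> {1..r}"
    and "1 \<le> s" "1 \<le> r" "2 \<le> m"
    and large: "2 * r * (s + 1) \<le> m"
    and size: "2 * K * (2 * r * s) ^ s \<le> m\<^sup>2"
  obtains S where "S \<subseteq> X" "card S = s"
    "K \<le> card {(u, v) \<in> Y \<times> Y. u \<noteq> v \<and> (\<forall>x\<in>S. f x u = f x v)}"
proof -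
  define P where "P = {(u, v) \<in> Y \<times> Y. u \<noteq> v}"
  define D where "D p = {x \<in> X. f x (fst p) = f x (snd p)}" for p
  define \<S> where "\<S> = {S. S \<subseteq> X \<and> card S = s}"
  have "P \<subseteq> Y \<times> Y"
    by (auto simp: P_def)
  then have "finite P"
    using \<open>finite Y\<close> finite_subset by blast
  have "finite \<S>"
    unfolding \<S>_def using \<open>finite X\<close> by simp
  have card_\<S>: "card \<S> = m choose s"
    unfolding \<S>_def using n_subsets[OF \<open>finite X\<close>] \<open>card X = m\<close> by simp
  \<comment> \<open>Both bounds on \<open>card P\<close> matter: the upper one when
    \<open>card P\<close> is subtracted and when the sum of \<open>e\<close> becomes a mean, the
    lower one when the incidences are compared with \<open>K\<close>.\<close>
  have "card P \<le> card (Y \<times> Y)"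
    using \<open>P \<subseteq> Y \<times> Y\<close> \<open>finite Y\<close> by (intro card_mono) auto
  then have card_P_le: "real (card P) \<le> (real m)\<^sup>2"
    using \<open>card Y = m\<close> by (simp add: card_cartesian_product power2_eq_square flip: of_nat_mult)
  \<comment> \<open>A constant function has a single fibre, so the pair count yields all pairs off
    the diagonal.\<close>
  have "real (card Y) * real (card Y) - real (card Y) \<le> real (card P)"
    using card_equal_value_distinct_pairs_ge[of Y "\<lambda>_. 1" 1] \<open>finite Y\<close>
    by (simp add: P_def power2_eq_square)
  moreover have "2 * real m \<le> real m * real m"
    using \<open>2 \<le> m\<close> by (intro mult_right_mono) auto
  ultimately have card_P_ge: "(real m)\<^sup>2 / 2 \<le> real (card P)"
    using \<open>card Y = m\<close> by (simp add: power2_eq_square)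
  \<comment> \<open>On average \<open>card (D p)\<close> is about \<open>m / r\<close>. Half of it
    is given up for the diagonal and for the 1 subtracted in \<open>e\<close>; \<open>large\<close>
    says exactly that this half suffices.\<close>
  define A where "A = real m / (2 * real r * real s)"
  have "0 < A"
    using assms by (simp add: A_def)

  have "(\<Sum>p\<in>P. card (D p)) = (\<Sum>x\<in>X. card {p \<in> P. f x (fst p) = f x (snd p)})"
    using sum.swap_restrict[of P X "\<lambda>_ _. 1::nat" "\<lambda>p x. f x (fst p) = f x (snd p)"]
      \<open>finite P\<close> \<open>finite X\<close> by (simp add: D_def)
  then have "(\<Sum>p\<in>P. real (card (D p))) = (\<Sum>x\<in>X. real (card {p \<in> P. f x (fst p) = f x (snd p)}))"
    by (simp only: flip: of_nat_sum)
  also have "\<dots> \<ge> (\<Sum>x\<in>X. (real m)\<^sup>2 / real r - real m)"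
  proof (rule sum_mono)
    fix x assume "x \<in> X"
    have "{p \<in> P. f x (fst p) = f x (snd p)} = {(u, v) \<in> Y \<times> Y. u \<noteq> v \<and> f x u = f x v}"
      by (auto simp: P_def)
    then show "(real m)\<^sup>2 / real r - real m \<le> real (card {p \<in> P. f x (fst p) = f x (snd p)})"
      using card_equal_value_distinct_pairs_ge[OF \<open>finite Y\<close> range[OF \<open>x \<in> X\<close>] \<open>1 \<le> r\<close>] \<open>card Y = m\<close>
      by simp
  qed
  finally have sum_D: "real m * ((real m)\<^sup>2 / real r - real m) \<le> (\<Sum>p\<in>P. real (card (D p)))"
    using \<open>card X = m\<close> by simp

  \<comment> \<open>For \<open>0 < d < s\<close> the power \<open>(d / s) ^ s\<close> would exceed
    \<open>d choose s\<close>, hence the subtracted 1. Truncation at 0 supplies the nonnegativity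
    that the convexity bound demands.\<close>
  define e where "e p = max 0 (real (card (D p)) / real s - 1)" for p
  have "2 * real r * (real s + 1) \<le> real m"
    using of_nat_mono[OF large, where 'a = real] by (simp add: algebra_simps)
  then have "real s * A \<le> real m / real r - 1 - real s"
    using assms by (simp add: A_def field_simps)
  then have "(real m)\<^sup>2 * (real s * A) \<le> (real m)\<^sup>2 * (real m / real r - 1 - real s)"
    by (rule mult_left_mono) simp
  also have "\<dots> = real m * ((real m)\<^sup>2 / real r - real m) - (real m)\<^sup>2 * real s"
    by (simp add: algebra_simps power2_eq_square)
  also have "\<dots> \<le> (\<Sum>p\<in>P. real (card (D p))) - real (card P) * real s"
    using sum_D card_P_le by (intro diff_mono mult_right_mono) auto
  also have "\<dots> = real s * (\<Sum>p\<in>P. real (card (D p)) / real s - 1)"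
    using \<open>1 \<le> s\<close> by (simp add: sum_subtractf sum_divide_distrib[symmetric] field_simps)
  also have "\<dots> \<le> real s * sum e P"
    by (intro mult_left_mono sum_mono) (auto simp: e_def)
  finally have "(real m)\<^sup>2 * A \<le> sum e P"
    using \<open>1 \<le> s\<close> by simp
  then have "real (card P) * A \<le> sum e P"
    using mult_right_mono[OF card_P_le, of A] \<open>0 < A\<close> by linarith
  then have "real (card P) * A ^ s \<le> (\<Sum>p\<in>P. e p ^ s)"
    by (intro sum_power_ge_card_mult_power \<open>0 < A\<close>) (auto simp: e_def)
  also have "\<dots> \<le> (\<Sum>p\<in>P. real (card (D p) choose s))"
    unfolding e_def by (intro sum_mono binomial_ge_power_max \<open>1 \<le> s\<close>)
  also have "\<dots> = real (\<Sum>p\<in>P. card {S \<in> \<S>. S \<subseteq> D p})"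
  proof -
    have "{S \<in> \<S>. S \<subseteq> D p} = {S. S \<subseteq> D p \<and> card S = s}" for p
      by (auto simp: \<S>_def D_def)
    moreover have "finite (D p)" for p
      using \<open>finite X\<close> by (simp add: D_def)
    ultimately show ?thesis
      by (simp add: n_subsets)
  qed
  also have "(\<Sum>p\<in>P. card {S \<in> \<S>. S \<subseteq> D p}) = (\<Sum>S\<in>\<S>. card {p \<in> P. S \<subseteq> D p})"
    using sum.swap_restrict[of P \<S> "\<lambda>_ _. 1::nat" "\<lambda>p S. S \<subseteq> D p"] \<open>finite P\<close> \<open>finite \<S>\<close> by simp
  finally have upper: "real (card P) * A ^ s \<le> real (\<Sum>S\<in>\<S>. card {p \<in> P. S \<subseteq> D p})" .

  \<comment> \<open>The factor \<open>(2 * r * s) ^ s\<close> cancels the denominator of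
    \<open>A ^ s\<close>, leaving \<open>m ^ s\<close>, the bound for the number of sets
    \<open>S\<close>.\<close>
  have "real (2 * K * (2 * r * s) ^ s) \<le> real (m\<^sup>2)"
    using size by (simp only: of_nat_le_iff)
  then have "real K * (2 * real r * real s) ^ s \<le> (real m)\<^sup>2 / 2"
    by simp
  then have "real K * (2 * real r * real s) ^ s * A ^ s \<le> real (card P) * A ^ s"
    using card_P_ge \<open>0 < A\<close> by (intro mult_right_mono) auto
  moreover have "(2 * real r * real s) ^ s * A ^ s = real m ^ s"
    using \<open>1 \<le> s\<close> \<open>1 \<le> r\<close> by (simp add: A_def power_mult_distrib[symmetric])
  ultimately have "real K * real m ^ s \<le> real (\<Sum>S\<in>\<S>. card {p \<in> P. S \<subseteq> D p})"
    using upper by (simp add: mult.assoc)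
  then have lower: "K * m ^ s \<le> (\<Sum>S\<in>\<S>. card {p \<in> P. S \<subseteq> D p})"
    by (simp only: of_nat_le_iff flip: of_nat_mult of_nat_power)

  \<comment> \<open>This makes \<open>\<S>\<close> nonempty, as averaging requires.\<close>
  have "s \<le> m"
  proof -
    have "1 * (s + 1) \<le> 2 * r * (s + 1)"
      using \<open>1 \<le> r\<close> by (intro mult_le_mono1) simp
    with large show ?thesis by simp
  qed
  then have "card \<S> \<le> m ^ s" "0 < card \<S>"
    by (simp_all add: card_\<S> binomial_le_pow zero_less_binomial)
  have "\<exists>S\<in>\<S>. K \<le> card {p \<in> P. S \<subseteq> D p}"
  proof (rule ccontr)
    assume "\<not> ?thesis"
    then have "(\<Sum>S\<in>\<S>. card {p \<in> P. S \<subseteq> D p}) < (\<Sum>S\<in>\<S>. K)"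
      using \<open>0 < card \<S>\<close> \<open>finite \<S>\<close> by (intro sum_strict_mono) auto
    also have "\<dots> \<le> K * m ^ s"
      using \<open>card \<S> \<le> m ^ s\<close> by simp
    finally show False
      using lower by simp
  qed
  then obtain S where "S \<in> \<S>" "K \<le> card {p \<in> P. S \<subseteq> D p}"
    by blast
  moreover have "{p \<in> P. S \<subseteq> D p} = {(u, v) \<in> Y \<times> Y. u \<noteq> v \<and> (\<forall>x\<in>S. f x u = f x v)}"
    using \<open>S \<in> \<S>\<close> by (auto simp: P_def D_def \<S>_def)
  ultimately show thesis
    using that by (auto simp: \<S>_def)
qed

section \<open>From agreeing pairs to a set with even colour counts\<close>

lemma exists_even_subset:
  fixes f :: "'a \<Rightarrow> 'b \<Rightarrow> 'c"
  assumes "finite Y" and "even t"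
    and many: "(t + 1)\<^sup>2 \<le> card {(u, v) \<in> Y \<times> Y. u \<noteq> v \<and> (\<forall>x\<in>S. f x u = f x v)}"
  obtains T where "T \<subseteq> Y" "card T = t" "\<And>x c. x \<in> S \<Longrightarrow> even (card {y \<in> T. f x y = c})"
proof -
  \<comment> \<open>A largest good set \<open>T\<close> with fewer than \<open>t\<close> elements leaves no agreeing pair in \<open>Y - T\<close>, so
    each element of \<open>T\<close> agrees with at most one element of \<open>Y - T\<close>.\<close>
  define good where "good T \<longleftrightarrow> T \<subseteq> Y \<and> card T \<le> t \<and> even (card T) \<and>
    (\<forall>x\<in>S. \<forall>c. even (card {y \<in> T. f x y = c}))" for T
  have "good {}"
    by (simp add: good_def)
  moreover have "\<forall>T. good T \<longrightarrow> card T < Suc t"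
    by (simp add: good_def)
  ultimately obtain T where T: "good T" and max: "\<And>T'. good T' \<Longrightarrow> card T' \<le> card T"
    using ex_has_greatest_nat[of good "{}" card "Suc t"] by (metis less_imp_le)
  have "finite T"
    using T \<open>finite Y\<close> finite_subset by (auto simp: good_def)
  have "card T = t"
  proof (rule ccontr)
    assume "card T \<noteq> t"
    \<comment> \<open>Both numbers are even, so the gap leaves room for a whole pair.\<close>
    then have room: "card T + 2 \<le> t"
      using T \<open>even t\<close> unfolding good_def by (auto elim!: evenE)
    \<comment> \<open>Adding an agreeing pair changes each colour count at each \<open>x\<close> by
      0 or 2, so \<open>T\<close> would not be largest.\<close>
    have sep: "u = v" if "u \<in> Y - T" "v \<in> Y - T" and agree: "\<forall>x\<in>S. f x u = f x v" for u v
    proof (rule ccontr)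
      assume "u \<noteq> v"
      have "even (card {y \<in> insert u (insert v T). f x y = c})" if "x \<in> S" for x c
      proof (cases "f x u = c")
        case True
        then have "{y \<in> insert u (insert v T). f x y = c} = insert u (insert v {y \<in> T. f x y = c})"
          using agree \<open>x \<in> S\<close> by auto
        then show ?thesis
          using T \<open>x \<in> S\<close> \<open>u \<noteq> v\<close> \<open>u \<in> Y - T\<close> \<open>v \<in> Y - T\<close> \<open>finite T\<close> by (simp add: good_def)
      next
        case False
        then have "{y \<in> insert u (insert v T). f x y = c} = {y \<in> T. f x y = c}"
          using agree \<open>x \<in> S\<close> by auto
        then show ?thesis
          using T \<open>x \<in> S\<close> by (simp add: good_def)
      qed
      moreover have card_ins: "card (insert u (insert v T)) = card T + 2"
        using \<open>u \<noteq> v\<close> that \<open>finite T\<close> by simp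
      ultimately have "good (insert u (insert v T))"
        using T room that unfolding good_def by auto
      from max[OF this] card_ins show False
        by simp
    qed
    \<comment> \<open>Every agreeing pair lies in \<open>T \<times> T\<close>, in \<open>B\<close>
      or in the reversal of \<open>B\<close>. By \<open>sep\<close>, a pair in \<open>B\<close> is
      determined by its first entry. The total is at most
      \<open>card T * card T + 2 * card T\<close>, one less than
      \<open>(card T + 1)\<^sup>2\<close>; this is the source of the threshold in
      \<open>many\<close>.\<close>
    define B where "B = {(u, v) \<in> T \<times> (Y - T). \<forall>x\<in>S. f x u = f x v}"
    have "inj_on fst B"
      by (rule inj_onI) (auto simp: B_def intro: sep)
    then have "card B \<le> card T"
      by (rule card_inj_on_le) (auto simp: B_def \<open>finite T\<close>)
    have "B \<subseteq> Y \<times> Y"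
      using T by (auto simp: B_def good_def)
    then have "finite B"
      using \<open>finite Y\<close> finite_subset by blast
    have "(u, v) \<in> T \<times> T \<union> (B \<union> prod.swap ` B)"
      if uv: "u \<in> Y" "v \<in> Y" "u \<noteq> v" and agree: "\<forall>x\<in>S. f x u = f x v" for u v
    proof -
      consider "u \<in> T" "v \<in> T" | "u \<in> T" "v \<notin> T" | "u \<notin> T" "v \<in> T"
        using sep[of u v] uv agree by blast
      then show ?thesis
      proof cases
        case 3
        then have "(v, u) \<in> B"
          using uv agree by (simp add: B_def)
        then show ?thesis
          by (metis UnI2 imageI swap_simp)
      qed (use uv agree in \<open>auto simp: B_def\<close>)
    qed
    then have "{(u, v) \<in> Y \<times> Y. u \<noteq> v \<and> (\<forall>x\<in>S. f x u = f x v)} \<subseteq> T \<times> T \<union> (B \<union> prod.swap ` B)"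
      by (simp only: subset_iff split_paired_all mem_Collect_eq case_prod_conv mem_Sigma_iff) blast
    then have "card {(u, v) \<in> Y \<times> Y. u \<noteq> v \<and> (\<forall>x\<in>S. f x u = f x v)} \<le> card (T \<times> T \<union> (B \<union> prod.swap ` B))"
      using \<open>finite T\<close> \<open>finite B\<close> by (intro card_mono) auto
    also have "\<dots> \<le> card (T \<times> T) + (card B + card (prod.swap ` B))"
      by (meson add_le_mono card_Un_le le_refl le_trans)
    also have "\<dots> \<le> card T * card T + (card T + card T)"
      using \<open>card B \<le> card T\<close> card_image_le[OF \<open>finite B\<close>, of prod.swap] by (simp add: card_cartesian_product)
    also have "\<dots> < (card T + 1)\<^sup>2"
      by (simp add: power2_eq_square)
    also have "\<dots> \<le> (t + 1)\<^sup>2"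
      using room by (intro power_mono) auto
    finally show False
      using many by simp
  qed
  then show thesis
    using that T by (auto simp: good_def)
qed

section \<open>Bipartite copies with every colour occurring evenly\<close>

lemma complete_bipartite_copy:
  assumes "S \<subseteq> {1..n}" "T \<subseteq> {1..n}" "S \<inter> T = {}" "card S = s" "card T = t"
  shows "(S \<union> T, (\<lambda>(x, y). {x, y}) ` (S \<times> T)) \<in> copies (complete_bipartite s t) (complete_graph n)"
proof -
  have "finite S" "finite T"
    using assms finite_subset by blast+
  then obtain g h where g: "bij_betw g {1..s} S" and h: "bij_betw h {1..t} T"
    using finite_same_card_bij[of "{1..s}" S] finite_same_card_bij[of "{1..t}" T] assms by auto
  have imgs: "S = g ` {1..s}" "T = h ` {1..t}"
    using g h by (simp_all add: bij_betw_def)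
  have "bij_betw (case_sum g h) ({1..s} <+> {1..t}) (S \<union> T)"
    unfolding bij_betw_def
  proof
    have "g i \<noteq> h j" if "i \<in> {1..s}" "j \<in> {1..t}" for i j
      using \<open>S \<inter> T = {}\<close> that imgs by blast
    then show "inj_on (case_sum g h) ({1..s} <+> {1..t})"
      using bij_betw_imp_inj_on[OF g] bij_betw_imp_inj_on[OF h]
      by (intro inj_onI; elim PlusE; hypsubst; simp del: atLeastAtMost_iff; metis inj_onD)
    show "case_sum g h ` ({1..s} <+> {1..t}) = S \<union> T"
      unfolding imgs by (auto simp: Plus_def image_Un image_image)
  qed
  moreover have "(\<lambda>(x, y). {x, y}) ` (S \<times> T) =
      (\<lambda>e. case_sum g h ` e) ` {{Inl i, Inr j} | i j. i \<in> {1..s} \<and> j \<in> {1..t}}"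
    (is "?L = ?R")
  proof
    show "?L \<subseteq> ?R"
    proof
      fix e assume "e \<in> ?L"
      then obtain i j where "i \<in> {1..s}" "j \<in> {1..t}" "e = {g i, h j}"
        unfolding imgs by auto
      then show "e \<in> ?R"
        by (intro image_eqI[of _ _ "{Inl i, Inr j}"]) auto
    qed
    show "?R \<subseteq> ?L"
      unfolding imgs by auto
  qed
  moreover have "(\<lambda>(x, y). {x, y}) ` (S \<times> T) \<subseteq> [{1..n}]\<^bsup>2\<^esup>"
    using assms(1-3) by (auto simp: nsets_def card_insert_if)
  ultimately show ?thesis
    using assms(1,2) by (auto simp: copies_def graph_iso_def complete_bipartite_def complete_graph_def)
qed

text \<open>Each colour count on the copy spanned by \<open>S\<close> and \<open>T\<close> is a sum,
  over \<open>x\<close> in \<open>S\<close>, of counts within \<open>T\<close> that are even by the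
  choice of \<open>T\<close>.\<close>

lemma not_odd_ramsey_coloring_complete_bipartite:
  assumes "1 \<le> s" "even t" "1 \<le> r" "2 \<le> m" "2 * m \<le> n"
    and "2 * r * (s + 1) \<le> m"
    and "2 * (t + 1)\<^sup>2 * (2 * r * s) ^ s \<le> m\<^sup>2"
  shows "\<not> odd_ramsey_coloring n (complete_bipartite s t) r \<chi>"
proof
  assume \<chi>: "odd_ramsey_coloring n (complete_bipartite s t) r \<chi>"
  define X Y where "X = {1..m}" and "Y = {m+1..2*m}"
  have range: "(\<lambda>y. \<chi> {x, y}) \<in> Y \<rightarrow> {1..r}" if "x \<in> X" for x
  proof
    fix y assume "y \<in> Y"
    then have "{x, y} \<in> [{1..n}]\<^bsup>2\<^esup>"
      using that \<open>2 * m \<le> n\<close> by (auto simp: nsets_def X_def Y_def)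
    then show "\<chi> {x, y} \<in> {1..r}"
      using \<chi> by (auto simp: odd_ramsey_coloring_def complete_graph_def)
  qed
  obtain S where S: "S \<subseteq> X" "card S = s"
    and pairs: "(t + 1)\<^sup>2 \<le> card {(u, v) \<in> Y \<times> Y. u \<noteq> v \<and> (\<forall>x\<in>S. \<chi> {x, u} = \<chi> {x, v})}"
    using exists_subset_many_agreeing_pairs[of X Y m "\<lambda>x y. \<chi> {x, y}" r s "(t + 1)\<^sup>2"] range assms
    by (auto simp: X_def Y_def)
  obtain T where T: "T \<subseteq> Y" "card T = t"
    and even_T: "\<And>x c. x \<in> S \<Longrightarrow> even (card {y \<in> T. \<chi> {x, y} = c})"
    using exists_even_subset[OF _ \<open>even t\<close> pairs] by (auto simp: Y_def)
  have "X \<inter> Y = {}"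
    by (auto simp: X_def Y_def)
  then have "S \<inter> T = {}"
    using S T by blast
  have fin: "finite S" "finite T"
    using S T finite_subset by (auto simp: X_def Y_def)
  define F where "F = (S \<union> T, (\<lambda>(x, y). {x, y}) ` (S \<times> T))"
  have "F \<in> copies (complete_bipartite s t) (complete_graph n)"
    unfolding F_def using S T \<open>S \<inter> T = {}\<close> \<open>2 * m \<le> n\<close>
    by (intro complete_bipartite_copy) (auto simp: X_def Y_def)
  then obtain c where c: "odd (card {e \<in> edges F. \<chi> e = c})"
    using \<chi> by (auto simp: odd_ramsey_coloring_def)
  have "{e \<in> edges F. \<chi> e = c} = (\<lambda>(x, y). {x, y}) ` (SIGMA x:S. {y \<in> T. \<chi> {x, y} = c})"
    by (auto simp: F_def)
  \<comment> \<open>As \<open>S\<close> and \<open>T\<close> are disjoint, an edge determines which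
    of its ends lies in \<open>S\<close>, so no edge is counted twice.\<close>
  moreover have "inj_on (\<lambda>(x, y). {x, y}) (SIGMA x:S. {y \<in> T. \<chi> {x, y} = c})"
    using \<open>S \<inter> T = {}\<close> by (auto simp: inj_on_def doubleton_eq_iff)
  ultimately have "card {e \<in> edges F. \<chi> e = c} = (\<Sum>x\<in>S. card {y \<in> T. \<chi> {x, y} = c})"
    using fin by (simp add: card_image)
  also have "even \<dots>"
    using even_T by (intro dvd_sum) auto
  finally show False
    using c by simp
qed

section \<open>Asymptotics for exponents below 2/s\<close>

theorem odd_ramsey_complete_bipartite_gt:
  fixes s t :: nat and a :: real
  assumes "1 \<le> s" "1 \<le> t" "even t" and "0 \<le> a" "a < 1" "a * real s < 2"
  shows "\<forall>\<^sub>F n in sequentially. real n powr a < real (odd_ramsey n (complete_bipartite s t))"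
proof -
  \<comment> \<open>With \<open>r\<close> at most \<open>n powr a\<close>, the size condition of the
    colouring lemma follows from \<open>C * n powr (a * s) \<le> m\<^sup>2\<close>. Here
    \<open>m = n div 2\<close>, and \<open>n / 3\<close> is a lower bound for it that avoids
    rounding.\<close>
  define C where "C = 2 * (real t + 1)\<^sup>2 * (2 * real s) ^ s"
  have "\<forall>\<^sub>F n in sequentially. 2 * (real s + 1) * real n powr a \<le> real n / 3"
    using assms(4,5) by real_asymp
  moreover have "\<forall>\<^sub>F n in sequentially. C * real n powr (a * real s) \<le> (real n / 3)\<^sup>2"
    using assms(6) by real_asymp
  moreover have "\<forall>\<^sub>F n in sequentially. (6::nat) \<le> n"
    by (rule eventually_ge_at_top)
  ultimately show ?thesis
  proof eventually_elim
    case (elim n)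
    define r where "r = odd_ramsey n (complete_bipartite s t)"
    have "edges (complete_bipartite s t) \<noteq> {}"
      using \<open>1 \<le> s\<close> \<open>1 \<le> t\<close> by (auto simp: complete_bipartite_def)
    then obtain \<chi> where "1 \<le> r" and \<chi>: "odd_ramsey_coloring n (complete_bipartite s t) r \<chi>"
      using odd_ramsey_attained unfolding r_def by blast
    have m: "real n / 3 \<le> real (n div 2)" "2 \<le> n div 2"
      using elim(3) by linarith+
    show ?case
    proof (rule ccontr)
      assume "\<not> ?case"
      then have r: "real r \<le> real n powr a"
        by (simp add: r_def)
      have "real (2 * r * (s + 1)) \<le> 2 * (real s + 1) * real n powr a"
        using mult_left_mono[OF r, of "2 * (real s + 1)"] by (simp add: algebra_simps)
      then have 1: "2 * r * (s + 1) \<le> n div 2"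
        using elim(1) m(1) by (metis of_nat_le_iff order_trans)
      have "real (2 * (t + 1)\<^sup>2 * (2 * r * s) ^ s) = C * real r ^ s"
        by (simp add: C_def power_mult_distrib algebra_simps)
      also have "\<dots> \<le> C * (real n powr a) ^ s"
        using r by (intro mult_left_mono power_mono) (auto simp: C_def)
      also have "\<dots> = C * real n powr (a * real s)"
        using elim(3) by (simp add: powr_realpow[symmetric] powr_powr)
      also have "\<dots> \<le> (real n / 3)\<^sup>2"
        by (rule elim(2))
      also have "\<dots> \<le> (real (n div 2))\<^sup>2"
        using m(1) by (intro power_mono) auto
      finally have 2: "2 * (t + 1)\<^sup>2 * (2 * r * s) ^ s \<le> (n div 2)\<^sup>2"
        by (metis of_nat_le_iff of_nat_power)
      show False
        using not_odd_ramsey_coloring_complete_bipartite[OF \<open>1 \<le> s\<close> \<open>even t\<close> \<open>1 \<le> r\<close> m(2) _ 1 2] \<chi>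
        by simp
    qed
  qed
qed

theorem theorem1p3:
  fixes s t :: nat
  assumes "3 \<le> s" and "s \<le> t" and "odd s" and "even t"
  shows "\<exists>N. \<forall>n\<ge>N.
    real (odd_ramsey n (complete_bipartite s t)) >
      real n powr (if t div 8 = 0 then 0
                   else 1 / (real s / 2 + 1 / (2 * real (t div 8))))"
proof -
  \<comment> \<open>The separate case matters: since \<open>1 / 0 = 0\<close>, the formula alone
    would give the exponent \<open>2 / s\<close> for \<open>t < 8\<close>, not the 0 of the
    convention.\<close>
  define a where "a = (if t div 8 = 0 then 0 else 1 / (real s / 2 + 1 / (2 * real (t div 8))))"
  have "0 \<le> a \<and> a < 1 \<and> a * real s < 2"
  proof (cases "t div 8 = 0")
    case True
    then show ?thesis
      by (simp add: a_def)
  next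
    case False
    define q where "q = real s / 2 + 1 / (2 * real (t div 8))"
    \<comment> \<open>The positive second summand puts the exponent strictly below
      \<open>2 / s\<close>, and \<open>3 \<le> s\<close> then puts it below 1.\<close>
    have "real s / 2 < q"
      using False by (simp add: q_def)
    moreover have "3 \<le> real s"
      using \<open>3 \<le> s\<close> by simp
    moreover have "a = 1 / q"
      using False by (simp add: a_def q_def)
    moreover from calculation have "1 < q"
      by linarith
    ultimately show ?thesis
      by (simp add: pos_divide_less_eq)
  qed
  then have "\<forall>\<^sub>F n in sequentially. real n powr a < real (odd_ramsey n (complete_bipartite s t))"
    using assms by (intro odd_ramsey_complete_bipartite_gt) auto
  then show ?thesis
    unfolding a_def eventually_sequentially .
qed

end
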